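(* Let $C_3$ denote the triangle (cycle on three vertices). There exists an assignment of nonzero real weights to the edges of $C_3$ such that $g(C_3;n)\gtrsim n$ for all large $n$; and for every assignment of nonzero real weights to the edges of $C_3$, $g(C_3;n)\lesssim n^{4/3}$.
   Context: For an edge-weighted graph $G$ (a finite graph with a weight function $w:E(G)\to\mathbb R$) on $k$ vertices, a $k$-tuple of points $X=(x_1,\dots,x_k)$ in $\mathbb R^2$ is a dot product $G$-configuration if there is a bijection $\varphi:V(G)\to X$ such that for every edge $\{u,v\}\in E(G)$, $\varphi(u)\cdot\varphi(v)=w(\{u,v\})$. For a natural number $n$, $g(G;n)$ denotes the maximum, over all sets $E$ of $n$ points in $\mathbb R^2$, of the number of dot product $G$-configurations with all points in $E$. For quantities depending on $n$, $X(n)\lesssim Y(n)$ means there are constants $C,N$ independent of $n$ with $X(n)\le CY(n)$ for all $n>N$; $\gtrsim$ is the reverse relation. *)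

theory Defs
  imports "HOL-Analysis.Analysis"
begin

text \<open>A finite simple graph is a pair of its vertex set and its set of (two-element) edges.
  Edge weights are kept separate, since the weights on a fixed graph are quantified over; only
  their values on edges of the graph matter.\<close>

type_synonym 'v graph = "'v set \<times> 'v set set"

abbreviation verts :: "'v graph \<Rightarrow> 'v set" where "verts \<equiv> fst"
abbreviation edges :: "'v graph \<Rightarrow> 'v set set" where "edges \<equiv> snd"

text \<open>Tuples of points are lists. Since the length of the tuple equals the number of vertices,
  the bijection onto its underlying point set forces the entries to be pairwise distinct.\<close>

definition dot_product_config ::
  "'v graph \<Rightarrow> ('v set \<Rightarrow> real) \<Rightarrow> (real ^ 2) list \<Rightarrow> bool" where
  "dot_product_config G w X \<longleftrightarrow>
     length X = card (verts G) \<and>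
     (\<exists>\<phi>. bij_betw \<phi> (verts G) (set X) \<and>
          (\<forall>u v. {u, v} \<in> edges G \<longrightarrow> \<phi> u \<bullet> \<phi> v = w {u, v}))"

text \<open>For a finite graph the set below is nonempty and bounded (by \<open>n ^ k\<close> for \<open>k\<close> vertices),
  so the maximum exists.\<close>

definition max_configs :: "'v graph \<Rightarrow> ('v set \<Rightarrow> real) \<Rightarrow> nat \<Rightarrow> nat" where
  "max_configs G w n =
     Max {card {X. dot_product_config G w X \<and> set X \<subseteq> E} | E. finite E \<and> card E = n}"

definition triangle_graph :: "nat graph" where
  "triangle_graph = ({0, 1, 2}, {{0, 1}, {1, 2}, {2, 0}})"

definition nonzero_weights :: "'v graph \<Rightarrow> ('v set \<Rightarrow> real) \<Rightarrow> bool" where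
  "nonzero_weights G w \<longleftrightarrow> (\<forall>e \<in> edges G. w e \<noteq> 0)"

definition lesssim :: "(nat \<Rightarrow> real) \<Rightarrow> (nat \<Rightarrow> real) \<Rightarrow> bool"  (infix "\<lesssim>" 50) where
  "X \<lesssim> Y \<longleftrightarrow> (\<exists>C N. \<forall>n>N. X n \<le> C * Y n)"

abbreviation (input) gtrsim :: "(nat \<Rightarrow> real) \<Rightarrow> (nat \<Rightarrow> real) \<Rightarrow> bool"  (infix "\<greatersim>" 50) where
  "X \<greatersim> Y \<equiv> Y \<lesssim> X"

end

theory Submission
  imports Defs
begin

text \<open>If the first two vertices of a triangle are independent, they determine the third; otherwise
  the first and the third determine the second. So it suffices to bound the incidences between
  \<open>n\<close> points and the \<open>n\<close> lines \<open>{y. x \<bullet> y = a}\<close>, which is Szemeredi-Trotter. That is proved by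
  Szekely's argument: join consecutive points on each line, and compare the number of edges of the
  resulting straight-line drawing with its at most quadratically many crossings.

  The linear bound on the edges of a crossing-free straight-line drawing is obtained without Euler's
  formula. Charge an edge that is the steepest one leaving its left end to that end. Otherwise
  charge it to the leftmost vertex in the wedge between it and the next steeper edge from the same
  left end. That vertex sees the one edge directly below it or is its end, and sees the other
  directly above it or is its end, so it recovers the pair and is charged at most twice.\<close>

section \<open>Straight-line drawings of graphs\<close>

definition edge_height :: "(real \<times> real) \<times> (real \<times> real) \<Rightarrow> real \<Rightarrow> real" where
  "edge_height e x = snd (fst e) +
     (snd (snd e) - snd (fst e)) / (fst (snd e) - fst (fst e)) * (x - fst (fst e))"

definition over_edge :: "real \<Rightarrow> (real \<times> real) \<times> (real \<times> real) \<Rightarrow> bool" where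
  "over_edge x e \<longleftrightarrow> fst (fst e) < x \<and> x < fst (snd e)"

text \<open>Since \<open>over_edge\<close> is strict, edges that merely share an endpoint do not
  cross, whereas edges that overlap along a stretch do. An edge with its left end first crosses
  itself, so crossings are counted for distinct edges only.\<close>

definition edges_cross :: "(real \<times> real) \<times> (real \<times> real) \<Rightarrow> (real \<times> real) \<times> (real \<times> real) \<Rightarrow> bool" where
  "edges_cross d e \<longleftrightarrow> (\<exists>x. over_edge x d \<and> over_edge x e \<and> edge_height d x = edge_height e x)"

lemma edge_height_left [simp]: "edge_height e (fst (fst e)) = snd (fst e)"
  by (simp add: edge_height_def)

lemma edge_height_right [simp]:
  "fst (fst e) < fst (snd e) \<Longrightarrow> edge_height e (fst (snd e)) = snd (snd e)"
  by (simp add: edge_height_def)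

lemma continuous_on_edge_height [continuous_intros]: "continuous_on S (edge_height e)"
  unfolding edge_height_def by (intro continuous_intros)

lemma edge_heights_meet:
  assumes "x < y" "edge_height d x < edge_height e x" "edge_height e y < edge_height d y"
  obtains z where "x < z" "z < y" "edge_height d z = edge_height e z"
proof -
  have "continuous_on {x..y} (\<lambda>z. edge_height d z - edge_height e z)"
    by (intro continuous_intros)
  then obtain z where "x \<le> z" "z \<le> y" "edge_height d z - edge_height e z = 0"
    using IVT'[of "\<lambda>z. edge_height d z - edge_height e z" x 0 y] assms by auto
  then show thesis
    using that[of z] assms by (cases "z = x \<or> z = y") auto
qed

text \<open>With distinct abscissae a vertex is known from its first coordinate alone, and directing
  the edges to the right makes each one the graph of an affine function.\<close>

locale segment_graph =
  fixes P :: "(real \<times> real) set" and D :: "((real \<times> real) \<times> (real \<times> real)) set"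
  assumes finite_P: "finite P"
    and inj_P: "inj_on fst P"
    and D_sub: "D \<subseteq> P \<times> P"
    and D_lr: "e \<in> D \<Longrightarrow> fst (fst e) < fst (snd e)"
    and no_vertex_inside: "e \<in> D \<Longrightarrow> r \<in> P \<Longrightarrow> over_edge (fst r) e \<Longrightarrow> edge_height e (fst r) \<noteq> snd r"

lemma (in segment_graph) finite_edges: "finite D"
  using finite_P D_sub finite_subset by blast

section \<open>Linear edge bound for crossing-free drawings\<close>

locale plane_segment_graph = segment_graph +
  assumes no_crossing: "d \<in> D \<Longrightarrow> e \<in> D \<Longrightarrow> edges_cross d e \<Longrightarrow> d = e"
begin

definition slope :: "(real \<times> real) \<times> (real \<times> real) \<Rightarrow> real" where
  "slope e = (snd (snd e) - snd (fst e)) / (fst (snd e) - fst (fst e))"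

lemma height_slope: "edge_height e x = snd (fst e) + slope e * (x - fst (fst e))"
  by (simp add: edge_height_def slope_def)

lemma D_ends: "e \<in> D \<Longrightarrow> fst e \<in> P" "e \<in> D \<Longrightarrow> snd e \<in> P"
  using D_sub by (auto simp: mem_Times_iff)

lemma P_eqI: "p \<in> P \<Longrightarrow> q \<in> P \<Longrightarrow> fst p = fst q \<Longrightarrow> p = q"
  using inj_P by (auto dest: inj_onD)

text \<open>Equal slopes would make the two edges overlap near their common left end, which counts
  as a crossing. Hence slopes strictly order the edges that leave a vertex to the right.\<close>

lemma slope_inj:
  assumes "d \<in> D" "e \<in> D" "fst d = fst e" "slope d = slope e"
  shows "d = e"
proof (rule no_crossing[OF assms(1,2)])
  define x where "x = (fst (fst d) + min (fst (snd d)) (fst (snd e))) / 2"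
  have "over_edge x d" "over_edge x e"
    using D_lr[OF assms(1)] D_lr[OF assms(2)] assms(3) by (auto simp: over_edge_def x_def)
  then show "edges_cross d e"
    using assms(3,4) by (auto simp: edges_cross_def height_slope)
qed

definition steeper :: "(real \<times> real) \<times> (real \<times> real) \<Rightarrow> ((real \<times> real) \<times> (real \<times> real)) set" where
  "steeper e = {f \<in> D. fst f = fst e \<and> slope e < slope f}"

definition next_edge :: "(real \<times> real) \<times> (real \<times> real) \<Rightarrow> (real \<times> real) \<times> (real \<times> real)" where
  "next_edge e = arg_min_on slope (steeper e)"

lemma next_edge:
  assumes "steeper e \<noteq> {}"
  shows "next_edge e \<in> D" "fst (next_edge e) = fst e" "slope e < slope (next_edge e)"
    and "f \<in> D \<Longrightarrow> fst f = fst e \<Longrightarrow> slope e < slope f \<Longrightarrow> slope (next_edge e) \<le> slope f"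
proof -
  have fin: "finite (steeper e)"
    using finite_edges by (simp add: steeper_def)
  have "next_edge e \<in> steeper e"
    unfolding next_edge_def using arg_min_if_finite(1)[OF fin assms] .
  then show "next_edge e \<in> D" "fst (next_edge e) = fst e" "slope e < slope (next_edge e)"
    by (auto simp: steeper_def)
  show "slope (next_edge e) \<le> slope f" if "f \<in> D" "fst f = fst e" "slope e < slope f"
    unfolding next_edge_def using arg_min_least[OF fin assms, of f] that by (simp add: steeper_def)
qed

text \<open>The vertices between \<open>e\<close> and \<open>next_edge e\<close>, in a region that
  is closed except at the apex and cut off at the nearer right end. If \<open>next_edge e\<close>
  exists, that right end is a member.\<close>

definition wedge :: "(real \<times> real) \<times> (real \<times> real) \<Rightarrow> (real \<times> real) set" where
  "wedge e = {p \<in> P. fst (fst e) < fst p \<and> fst p \<le> fst (snd e) \<and> fst p \<le> fst (snd (next_edge e)) \<and>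
     edge_height e (fst p) \<le> snd p \<and> snd p \<le> edge_height (next_edge e) (fst p)}"

definition wedge_tip :: "(real \<times> real) \<times> (real \<times> real) \<Rightarrow> real \<times> real" where
  "wedge_tip e = arg_min_on fst (wedge e)"

lemma below_next_edge:
  assumes "steeper e \<noteq> {}" "fst (fst e) < x"
  shows "edge_height e x < edge_height (next_edge e) x"
  using next_edge(2,3)[OF assms(1)] assms(2) by (simp add: height_slope)

lemma wedge_tip:
  assumes e: "e \<in> D" "steeper e \<noteq> {}"
  shows "wedge_tip e \<in> wedge e" "p \<in> wedge e \<Longrightarrow> fst (wedge_tip e) \<le> fst p"
proof -
  have fin: "finite (wedge e)"
    using finite_P by (simp add: wedge_def)
  note f = next_edge(1,2)[OF e(2)]
  \<comment> \<open>The nearer right end lies on one side of the wedge and on the correct side of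
    the other, so a leftmost vertex exists.\<close>
  have "(if fst (snd e) \<le> fst (snd (next_edge e)) then snd e else snd (next_edge e)) \<in> wedge e"
    using D_lr[OF e(1)] D_lr[OF f(1)] f(2) D_ends[OF e(1)] D_ends[OF f(1)]
      below_next_edge[OF e(2), of "fst (snd e)"] below_next_edge[OF e(2), of "fst (snd (next_edge e))"]
    by (auto simp: wedge_def)
  then have ne: "wedge e \<noteq> {}" by blast
  show "wedge_tip e \<in> wedge e"
    unfolding wedge_tip_def using arg_min_if_finite(1)[OF fin ne] .
  show "fst (wedge_tip e) \<le> fst p" if "p \<in> wedge e"
    unfolding wedge_tip_def using arg_min_least[OF fin ne that] .
qed

lemma wedge_tip_in: "e \<in> D \<Longrightarrow> steeper e \<noteq> {} \<Longrightarrow> wedge_tip e \<in> P"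
  using wedge_tip(1)[of e] by (auto simp: wedge_def)

text \<open>An edge through the wedge over the abscissa of its leftmost vertex would, followed to the
  left, have to leave the wedge or end in it.\<close>

lemma no_edge_between:
  assumes e: "e \<in> D" "steeper e \<noteq> {}" and d: "d \<in> D"
    and over: "fst (fst d) < fst (wedge_tip e)" "fst (wedge_tip e) \<le> fst (snd d)"
    and lower: "edge_height e (fst (wedge_tip e)) < edge_height d (fst (wedge_tip e))"
  shows "edge_height (next_edge e) (fst (wedge_tip e)) \<le> edge_height d (fst (wedge_tip e))"
proof (rule ccontr)
  let ?f = "next_edge e" and ?p = "wedge_tip e"
  assume "\<not> ?thesis"
  then have upper: "edge_height d (fst ?p) < edge_height ?f (fst ?p)"
    by simp
  note f = next_edge[OF e(2)]
  have p: "fst (fst e) < fst ?p" "fst ?p \<le> fst (snd e)" "fst ?p \<le> fst (snd ?f)"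
    using wedge_tip(1)[OF e] by (auto simp: wedge_def)
  have ne: "d \<noteq> e" "d \<noteq> ?f"
    using lower upper by auto
  \<comment> \<open>Lying below \<open>e\<close> at \<open>x\<close> and above it at the tip forces
    a crossing in between; \<open>not_above\<close> is the mirror image.\<close>
  have not_below: False if x: "fst (fst d) \<le> x" "fst (fst e) \<le> x" "x < fst ?p"
    and lt: "edge_height d x < edge_height e x" for x
  proof -
    obtain z where "x < z" "z < fst ?p" "edge_height d z = edge_height e z"
      using edge_heights_meet[OF x(3) lt lower] by blast
    then have "edges_cross d e"
      using x p over unfolding edges_cross_def over_edge_def by (intro exI[of _ z]) auto
    then show False using no_crossing d e(1) ne(1) by blast
  qed
  have not_above: False if x: "fst (fst d) \<le> x" "fst (fst e) \<le> x" "x < fst ?p"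
    and lt: "edge_height ?f x < edge_height d x" for x
  proof -
    obtain z where "x < z" "z < fst ?p" "edge_height ?f z = edge_height d z"
      using edge_heights_meet[OF x(3) lt upper] by blast
    then have "edges_cross d ?f"
      using x p over f(2) unfolding edges_cross_def over_edge_def by (intro exI[of _ z]) auto
    then show False using no_crossing d f(1) ne(2) by blast
  qed
  \<comment> \<open>By where \<open>d\<close> starts. Left of the apex, it passes strictly above or
    below the apex, where both sides of the wedge meet. At the apex, its slope would lie strictly
    between two consecutive slopes. Right of the apex, its left end precedes the tip and so lies
    outside the wedge.\<close>
  consider "fst (fst d) < fst (fst e)" | "fst (fst d) = fst (fst e)" | "fst (fst e) < fst (fst d)"
    by linarith
  then show False
  proof cases
    case 1
    then have "edge_height d (fst (fst e)) \<noteq> snd (fst e)"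
      using no_vertex_inside[OF d D_ends(1)[OF e(1)]] p(1) over by (auto simp: over_edge_def)
    moreover have "edge_height ?f (fst (fst e)) = snd (fst e)"
      using f(2) edge_height_left[of ?f] by simp
    ultimately show False
      using not_below[of "fst (fst e)"] not_above[of "fst (fst e)"] 1 p(1) by force
  next
    case 2
    then have eq: "fst d = fst e"
      using P_eqI D_ends(1) d e(1) by blast
    have "slope e < slope d"
      using lower p(1) eq by (simp add: height_slope)
    moreover have "slope d < slope ?f"
      using upper p(1) eq f(2) by (simp add: height_slope not_le)
    ultimately show False
      using f(4)[OF d eq] by simp
  next
    case 3
    have "fst d \<notin> wedge e"
      using wedge_tip(2)[OF e, of "fst d"] over(1) by auto
    then have "snd (fst d) < edge_height e (fst (fst d)) \<or> edge_height ?f (fst (fst d)) < snd (fst d)"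
      using 3 D_ends(1)[OF d] over p by (auto simp: wedge_def)
    then show False
      using not_below[of "fst (fst d)"] not_above[of "fst (fst d)"] 3 over(1) by auto
  qed
qed

lemma height_eq_imp_eq:
  assumes "d \<in> D" "e \<in> D" "over_edge x d" "over_edge x e" "edge_height d x = edge_height e x"
  shows "d = e"
  using no_crossing assms unfolding edges_cross_def by blast

lemma over_edgeI:
  assumes "e \<in> D" "p \<in> P" "fst (fst e) < fst p" "fst p \<le> fst (snd e)" "edge_height e (fst p) \<noteq> snd p"
  shows "over_edge (fst p) e"
proof -
  have "fst p \<noteq> fst (snd e)"
  proof
    assume "fst p = fst (snd e)"
    then have "p = snd e" using P_eqI assms(1,2) D_ends by blast
    then show False using assms(5) D_lr[OF assms(1)] by simp
  qed
  then show ?thesis using assms by (simp add: over_edge_def)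
qed

lemma card_topmost: "card {e \<in> D. steeper e = {}} \<le> card P"
proof (rule card_inj_on_le[of fst])
  show "inj_on fst {e \<in> D. steeper e = {}}"
  proof (rule inj_onI)
    fix d e assume "d \<in> {e \<in> D. steeper e = {}}" "e \<in> {e \<in> D. steeper e = {}}" "fst d = fst e"
    moreover from this have "slope d = slope e"
      by (auto simp: steeper_def) (metis not_less_iff_gr_or_eq prod.collapse)
    ultimately show "d = e" using slope_inj by blast
  qed
qed (use finite_P D_ends in auto)

text \<open>Here \<open>e\<close> passes below its tip. If \<open>d\<close> has the same tip and
  were higher than \<open>e\<close> there, \<open>no_edge_between\<close> would put it at or above
  \<open>next_edge e\<close>, hence at or above the tip, contrary to its own membership. By symmetry
  both heights agree.\<close>

lemma card_tip_above:
  "card {e \<in> D. steeper e \<noteq> {} \<and> edge_height e (fst (wedge_tip e)) < snd (wedge_tip e)} \<le> card P"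
    (is "card ?A \<le> _")
proof (rule card_inj_on_le[of wedge_tip])
  show "inj_on wedge_tip ?A"
  proof (rule inj_onI)
    fix d e assume de: "d \<in> ?A" "e \<in> ?A" and eq: "wedge_tip d = wedge_tip e"
    let ?p = "wedge_tip e"
    have tip: "?p \<in> wedge d" "?p \<in> wedge e"
      using wedge_tip(1) de eq by fastforce+
    then have over: "over_edge (fst ?p) d" "over_edge (fst ?p) e"
      using de eq by (auto intro!: over_edgeI simp: wedge_def)
    have "edge_height d (fst ?p) \<le> edge_height e (fst ?p)"
      using no_edge_between[of e d] de over tip eq by (fastforce simp: wedge_def over_edge_def)
    moreover have "edge_height e (fst ?p) \<le> edge_height d (fst ?p)"
      using no_edge_between[of d e] de over tip eq by (fastforce simp: wedge_def over_edge_def)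
    ultimately show "d = e"
      using height_eq_imp_eq[OF _ _ over] de by simp
  qed
qed (use finite_P in \<open>auto intro!: wedge_tip_in\<close>)

text \<open>A vertex on \<open>e\<close> right of the apex can only be its right end, so the tip
  gives one end of \<open>e\<close>. The upper side \<open>next_edge e\<close> is the edge directly
  above the tip, hence also determined, and its left end is that of \<open>e\<close>.\<close>

lemma card_tip_on:
  "card {e \<in> D. steeper e \<noteq> {} \<and> edge_height e (fst (wedge_tip e)) = snd (wedge_tip e)} \<le> card P"
    (is "card ?A \<le> _")
proof (rule card_inj_on_le[of wedge_tip])
  show "inj_on wedge_tip ?A"
  proof (rule inj_onI)
    fix d e assume de: "d \<in> ?A" "e \<in> ?A" and eq: "wedge_tip d = wedge_tip e"
    let ?p = "wedge_tip e"
    have tip: "?p \<in> wedge d" "?p \<in> wedge e"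
      using wedge_tip(1) de eq by fastforce+
    have right: "snd c = ?p" if "c \<in> ?A" "?p \<in> wedge c" "wedge_tip c = ?p" for c
    proof -
      have "\<not> over_edge (fst ?p) c"
        using no_vertex_inside[of c ?p] that by (auto simp: wedge_def)
      then have "fst (snd c) = fst ?p"
        using that by (auto simp: wedge_def over_edge_def)
      then show ?thesis
        using P_eqI[of "snd c" ?p] that D_ends(2) by (auto simp: wedge_def)
    qed
    have above: "snd ?p < edge_height (next_edge c) (fst ?p)" "over_edge (fst ?p) (next_edge c)"
      if "c \<in> ?A" "?p \<in> wedge c" "wedge_tip c = ?p" for c
    proof -
      show *: "snd ?p < edge_height (next_edge c) (fst ?p)"
        using below_next_edge[of c "fst ?p"] that by (auto simp: wedge_def)
      show "over_edge (fst ?p) (next_edge c)"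
        using that next_edge[of c] * by (intro over_edgeI) (auto simp: wedge_def)
    qed
    have "edge_height (next_edge e) (fst ?p) \<le> edge_height (next_edge d) (fst ?p)"
      using no_edge_between[of e "next_edge d"] de tip above[of d] next_edge(1)[of d] eq
      by (auto simp: over_edge_def)
    moreover have "edge_height (next_edge d) (fst ?p) \<le> edge_height (next_edge e) (fst ?p)"
      using no_edge_between[of d "next_edge e"] de tip above[of e] next_edge(1)[of e] eq
      by (auto simp: over_edge_def)
    ultimately have "next_edge d = next_edge e"
      using de tip eq by (intro height_eq_imp_eq[of _ _ "fst ?p"] above next_edge(1)) auto
    then have "fst d = fst e"
      using next_edge(2)[of d] next_edge(2)[of e] de by simp
    then show "d = e"
      using right[of d] right[of e] de tip eq by (simp add: prod_eq_iff)
  qed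
qed (use finite_P in \<open>auto intro!: wedge_tip_in\<close>)

theorem card_edges_le: "card D \<le> 3 * card P"
proof -
  let ?T = "{e \<in> D. steeper e = {}}"
  let ?A = "{e \<in> D. steeper e \<noteq> {} \<and> edge_height e (fst (wedge_tip e)) < snd (wedge_tip e)}"
  let ?B = "{e \<in> D. steeper e \<noteq> {} \<and> edge_height e (fst (wedge_tip e)) = snd (wedge_tip e)}"
  have "D \<subseteq> ?T \<union> ?A \<union> ?B"
    using wedge_tip(1) by (force simp: wedge_def)
  then have "card D \<le> card (?T \<union> ?A \<union> ?B)"
    using finite_edges by (intro card_mono) auto
  also have "\<dots> \<le> card ?T + card ?A + card ?B"
    using card_Un_le[of "?T \<union> ?A" ?B] card_Un_le[of ?T ?A] by linarith
  finally show ?thesis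
    using card_topmost card_tip_above card_tip_on by linarith
qed

end

section \<open>The crossing lemma by random sampling\<close>

context segment_graph
begin

definition crossings :: "(((real \<times> real) \<times> (real \<times> real)) \<times> ((real \<times> real) \<times> (real \<times> real))) set" where
  "crossings = {(d, e). d \<in> D \<and> e \<in> D \<and> d \<noteq> e \<and> edges_cross d e}"

lemma finite_crossings: "finite crossings"
  by (rule finite_subset[of _ "D \<times> D"]) (auto simp: crossings_def finite_edges)

text \<open>Crossings are ordered pairs in both orders, so deleting all first components removes
  every edge involved in one and leaves a plane drawing. The bound is stated for every
  \<open>Q\<close> in order to be averaged over random vertex sets.\<close>

lemma card_edges_le_crossings:
  assumes "Q \<subseteq> P"
  shows "card {e \<in> D. \<forall>p\<in>{fst e, snd e}. p \<in> Q} \<le>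
    3 * card Q + card {x \<in> crossings. \<forall>p\<in>{fst (fst x), snd (fst x), fst (snd x), snd (snd x)}. p \<in> Q}"
    (is "card ?D \<le> _ + card ?C")
proof -
  have fin: "finite ?D" "finite ?C"
    using finite_edges finite_crossings by auto
  interpret Q: plane_segment_graph Q "?D - fst ` ?C"
  proof
    show "finite Q" "inj_on fst Q"
      using assms finite_P inj_P finite_subset inj_on_subset by blast+
    show "?D - fst ` ?C \<subseteq> Q \<times> Q"
      by (auto simp: mem_Times_iff)
    show "fst (fst e) < fst (snd e)" if "e \<in> ?D - fst ` ?C" for e
      using D_lr that by blast
    show "edge_height e (fst r) \<noteq> snd r" if "e \<in> ?D - fst ` ?C" "r \<in> Q" "over_edge (fst r) e" for e r
      using no_vertex_inside that assms by blast
    show "d = e" if "d \<in> ?D - fst ` ?C" "e \<in> ?D - fst ` ?C" "edges_cross d e" for d e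
    proof (rule ccontr)
      assume "d \<noteq> e"
      then have "(d, e) \<in> ?C"
        using that by (auto simp: crossings_def)
      then have "fst (d, e) \<in> fst ` ?C"
        by (rule imageI)
      then show False
        using that(1) unfolding Diff_iff fst_conv by blast
    qed
  qed
  have "card ?D \<le> card (?D - fst ` ?C) + card (fst ` ?C)"
    using card_Un_le[of "?D - fst ` ?C" "fst ` ?C"] card_mono[of "(?D - fst ` ?C) \<union> fst ` ?C" ?D] fin
    by force
  then show ?thesis
    using Q.card_edges_le card_image_le[OF fin(2), of fst] by linarith
qed

end

text \<open>The colours on \<open>A\<close> are forced and all others are free. The quotient form
  displays the probability \<open>1 / m ^ card A\<close>.\<close>

lemma card_colourings:
  assumes "finite P" "A \<subseteq> P" "0 < m"
  shows "real (card {c \<in> P \<rightarrow>\<^sub>E {..<m}. \<forall>p\<in>A. c p = 0}) = real m ^ card P / real m ^ card A"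
proof -
  have "{c \<in> P \<rightarrow>\<^sub>E {..<m}. \<forall>p\<in>A. c p = 0} = PiE P (\<lambda>p. if p \<in> A then {0} else {..<m})"
    (is "?L = ?R")
  proof (intro equalityI subsetI)
    fix c assume "c \<in> ?L"
    then show "c \<in> ?R"
      by (simp add: PiE_iff)
  next
    fix c assume c: "c \<in> ?R"
    have "c p < m \<and> (p \<in> A \<longrightarrow> c p = 0)" if "p \<in> P" for p
      using PiE_mem[OF c that] assms(3) by (cases "p \<in> A") simp_all
    then show "c \<in> ?L"
      using c assms(2) by (auto simp: PiE_iff)
  qed
  then have "card {c \<in> P \<rightarrow>\<^sub>E {..<m}. \<forall>p\<in>A. c p = 0} = (\<Prod>p\<in>P. if p \<in> A then 1 else m)"
    using assms(1) by (auto simp: card_PiE intro!: prod.cong)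
  also have "\<dots> = (\<Prod>p\<in>P - A. m)"
    using assms(1) by (intro prod.mono_neutral_cong_right) auto
  also have "\<dots> = m ^ (card P - card A)"
    using assms(1,2) by (simp add: card_Diff_subset finite_subset)
  finally show ?thesis
    unfolding of_nat_power using assms
    by (simp only: of_nat_power, intro power_diff card_mono) auto
qed

text \<open>Linearity of expectation without normalisation: swapping the sums counts, for each
  object \<open>b\<close> living on the \<open>k\<close> vertices \<open>A b\<close>, the colourings
  that keep it.\<close>

lemma sum_card_colourings:
  assumes "finite P" "finite B" "0 < m" "\<And>b. b \<in> B \<Longrightarrow> A b \<subseteq> P \<and> card (A b) = k"
  shows "(\<Sum>c\<in>P \<rightarrow>\<^sub>E {..<m}. real (card {b \<in> B. \<forall>p\<in>A b. c p = 0})) =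
    real (card B) * (real m ^ card P / real m ^ k)"
proof -
  have "(\<Sum>c\<in>P \<rightarrow>\<^sub>E {..<m}. real (card {b \<in> B. \<forall>p\<in>A b. c p = 0})) =
      (\<Sum>b\<in>B. real (card {c \<in> P \<rightarrow>\<^sub>E {..<m}. \<forall>p\<in>A b. c p = 0}))"
    using sum.swap_restrict[of "P \<rightarrow>\<^sub>E {..<m}" B "\<lambda>_ _. 1::real" "\<lambda>c b. \<forall>p\<in>A b. c p = 0"]
      assms(1,2) by (simp add: finite_PiE)
  also have "\<dots> = (\<Sum>b\<in>B. real m ^ card P / real m ^ k)"
    using assms by (intro sum.cong) (auto simp: card_colourings)
  finally show ?thesis by simp
qed

text \<open>Colour the vertices at random with \<open>m\<close> colours and keep the graph induced on one colour
  class: a vertex survives with probability \<open>1/m\<close>, an edge with \<open>1/m\<^sup>2\<close>, a crossing with \<open>1/m\<^sup>4\<close>.\<close>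

lemma (in segment_graph) crossing_lemma:
  assumes "0 < m"
    and four: "\<And>d e. (d, e) \<in> crossings \<Longrightarrow> card {fst d, snd d, fst e, snd e} = 4"
  shows "real (card D) \<le> 3 * real (card P) * real m + real (card crossings) / real m ^ 2"
proof -
  let ?\<Omega> = "P \<rightarrow>\<^sub>E {..<m}" and ?M = "real m ^ card P"
  have "(\<Sum>c\<in>?\<Omega>. real (card {e \<in> D. \<forall>p\<in>{fst e, snd e}. c p = 0})) \<le>
    (\<Sum>c\<in>?\<Omega>. 3 * real (card {q \<in> P. \<forall>p\<in>{q}. c p = 0}) +
       real (card {x \<in> crossings. \<forall>p\<in>{fst (fst x), snd (fst x), fst (snd x), snd (snd x)}. c p = 0}))"
  proof (rule sum_mono)
    fix c :: "real \<times> real \<Rightarrow> nat"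
    have 1: "{e \<in> D. \<forall>p\<in>{fst e, snd e}. p \<in> {q \<in> P. c q = 0}} = {e \<in> D. \<forall>p\<in>{fst e, snd e}. c p = 0}"
      using D_sub by auto
    have 2: "{x \<in> crossings. \<forall>p\<in>{fst (fst x), snd (fst x), fst (snd x), snd (snd x)}. p \<in> {q \<in> P. c q = 0}} =
      {x \<in> crossings. \<forall>p\<in>{fst (fst x), snd (fst x), fst (snd x), snd (snd x)}. c p = 0}"
      using D_sub by (auto simp: crossings_def)
    show "real (card {e \<in> D. \<forall>p\<in>{fst e, snd e}. c p = 0}) \<le>
      3 * real (card {q \<in> P. \<forall>p\<in>{q}. c p = 0}) +
       real (card {x \<in> crossings. \<forall>p\<in>{fst (fst x), snd (fst x), fst (snd x), snd (snd x)}. c p = 0})"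
      using card_edges_le_crossings[of "{q \<in> P. c q = 0}"] unfolding 1 2 by simp
  qed
  \<comment> \<open>The exponents 1, 4 and, below, 2 are the numbers of distinct vertices in a
    vertex, a crossing and an edge; \<open>four\<close> supplies the 4.\<close>
  also have "\<dots> = 3 * (real (card P) * (?M / real m ^ 1)) + real (card crossings) * (?M / real m ^ 4)"
    unfolding sum.distrib sum_distrib_left[symmetric]
    using D_sub four
    by (intro arg_cong2[where f="(+)"] arg_cong2[where f="(*)"] sum_card_colourings refl
          finite_P finite_crossings \<open>0 < m\<close>) (auto simp: crossings_def)
  also have "(\<Sum>c\<in>?\<Omega>. real (card {e \<in> D. \<forall>p\<in>{fst e, snd e}. c p = 0})) = real (card D) * (?M / real m ^ 2)"
    using D_sub D_lr by (intro sum_card_colourings finite_P finite_edges \<open>0 < m\<close>) (force simp: card_insert_if)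
  \<comment> \<open>This factor turns the sums into averages and isolates
    \<open>card D\<close>.\<close>
  finally have "real (card D) * (?M / real m ^ 2) * (real m ^ 2 / ?M) \<le>
      (3 * (real (card P) * (?M / real m ^ 1)) + real (card crossings) * (?M / real m ^ 4)) * (real m ^ 2 / ?M)"
    by (rule mult_right_mono) simp
  also have "\<dots> = 3 * real (card P) * real m + real (card crossings) / real m ^ 2"
    using \<open>0 < m\<close> by (simp add: distrib_right add_divide_distrib power2_eq_square power4_eq_xxxx)
  finally show ?thesis
    using \<open>0 < m\<close> by simp
qed

section \<open>The Szemeredi-Trotter theorem\<close>

definition on_line :: "real \<times> real \<Rightarrow> real \<times> real \<Rightarrow> bool" where
  "on_line l p \<longleftrightarrow> snd p = fst l * fst p + snd l"

lemma line_eqI: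
  fixes l l' :: "real \<times> real"
  assumes "fst l * x + snd l = fst l' * x + snd l'" "fst l * y + snd l = fst l' * y + snd l'" "x \<noteq> y"
  shows "l = l'"
proof -
  have "(fst l - fst l') * (x - y) = 0"
    using assms(1,2) by (simp add: algebra_simps)
  then have "fst l = fst l'" using assms(3) by simp
  then show ?thesis using assms(1) by (simp add: prod_eq_iff)
qed

lemma edge_height_on_line:
  assumes "on_line l (fst e)" "on_line l (snd e)" "fst (fst e) < fst (snd e)"
  shows "edge_height e x = fst l * x + snd l"
proof -
  have "(snd (snd e) - snd (fst e)) / (fst (snd e) - fst (fst e)) = fst l"
    using assms by (simp add: on_line_def divide_eq_eq algebra_simps)
  then show ?thesis
    using assms by (simp add: edge_height_def on_line_def algebra_simps)
qed

text \<open>A line with \<open>k > 0\<close> points of \<open>P\<close> yields \<open>k - 1\<close>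
  edges, so the incidences exceed the edges by at most \<open>card L\<close>. Distinct lines meet at
  most once, which bounds the crossings by the square of \<open>card L\<close>. The parameter
  \<open>m\<close> is left free so that the last two terms can be balanced later.\<close>

theorem szemeredi_trotter:
  assumes P: "finite P" "inj_on fst P" and L: "finite L" and "0 < m"
  shows "real (card {(l, p). l \<in> L \<and> p \<in> P \<and> on_line l p}) \<le>
    real (card L) + 3 * real (card P) * real m + (real (card L))\<^sup>2 / (real m)\<^sup>2"
proof -
  define link where "link l e \<longleftrightarrow> l \<in> L \<and> on_line l (fst e) \<and> on_line l (snd e) \<and>
    (\<forall>r\<in>P. on_line l r \<longrightarrow> \<not> over_edge (fst r) e)" for l e
  define D where "D = {e \<in> P \<times> P. fst (fst e) < fst (snd e) \<and> (\<exists>l. link l e)}"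
  define ln where "ln e = (SOME l. link l e)" for e
  have D_D: "fst e \<in> P" "snd e \<in> P" "fst (fst e) < fst (snd e)" "link (ln e) e" if "e \<in> D" for e
    using that someI_ex[of "\<lambda>l. link l e"] by (auto simp: D_def ln_def)
  have height: "edge_height e x = fst (ln e) * x + snd (ln e)" if "e \<in> D" for e x
    using D_D[OF that] by (intro edge_height_on_line) (auto simp: link_def)
  have P_eqI: "p = q" if "p \<in> P" "q \<in> P" "fst p = fst q" for p q
    using that P(2) by (auto dest: inj_onD)
  \<comment> \<open>On one line, neither edge has an end strictly inside the other, so overlapping
    edges share both ends.\<close>
  have same_edge: "d = e" if "d \<in> D" "e \<in> D" "ln d = ln e" "over_edge x d" "over_edge x e" for d e x
  proof -
    have "\<not> over_edge (fst (fst d)) e" "\<not> over_edge (fst (snd d)) e"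
        "\<not> over_edge (fst (fst e)) d" "\<not> over_edge (fst (snd e)) d"
      using D_D[OF \<open>d \<in> D\<close>] D_D[OF \<open>e \<in> D\<close>] \<open>ln d = ln e\<close> by (auto simp: link_def)
    then have "fst (fst d) = fst (fst e)" "fst (snd d) = fst (snd e)"
      using that(4,5) unfolding over_edge_def by linarith+
    then show ?thesis
      using P_eqI D_D \<open>d \<in> D\<close> \<open>e \<in> D\<close> by (meson prod_eqI)
  qed
  interpret segment_graph P D
  proof
    show "finite P" "inj_on fst P" "D \<subseteq> P \<times> P"
      using P by (auto simp: D_def)
    show "fst (fst e) < fst (snd e)" if "e \<in> D" for e
      using D_D that by blast
    show "edge_height e (fst r) \<noteq> snd r" if "e \<in> D" "r \<in> P" "over_edge (fst r) e" for e r
      using D_D(4)[OF that(1)] height[OF that(1)] that by (auto simp: link_def on_line_def)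
  qed
  have cross: "\<exists>x. d \<in> D \<and> e \<in> D \<and> over_edge x d \<and> over_edge x e \<and> ln d \<noteq> ln e \<and>
      fst (ln d) * x + snd (ln d) = fst (ln e) * x + snd (ln e)" if "(d, e) \<in> crossings" for d e
  proof -
    obtain x where x: "d \<in> D" "e \<in> D" "d \<noteq> e" "over_edge x d" "over_edge x e"
        "edge_height d x = edge_height e x"
      using \<open>(d, e) \<in> crossings\<close> by (auto simp: crossings_def edges_cross_def)
    then have "ln d \<noteq> ln e"
      using same_edge by blast
    then show ?thesis
      using x height[of d x] height[of e x] by auto
  qed
  \<comment> \<open>The two lines determine the abscissa of the crossing, and over it each line
    carries only one edge.\<close>
  have "card crossings \<le> card (L \<times> L)"
  proof (rule card_inj_on_le[of "\<lambda>(d, e). (ln d, ln e)"])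
    show "inj_on (\<lambda>(d, e). (ln d, ln e)) crossings"
    proof (rule inj_onI)
      fix u v
      assume uv: "u \<in> crossings" "v \<in> crossings" "(\<lambda>(d, e). (ln d, ln e)) u = (\<lambda>(d, e). (ln d, ln e)) v"
      obtain d e d' e' where [simp]: "u = (d, e)" "v = (d', e')"
        by (metis surj_pair)
      have c: "(d, e) \<in> crossings" "(d', e') \<in> crossings" and eq: "ln d = ln d'" "ln e = ln e'"
        using uv by auto
      obtain x where x: "d \<in> D" "e \<in> D" "over_edge x d" "over_edge x e" "ln d \<noteq> ln e"
          "fst (ln d) * x + snd (ln d) = fst (ln e) * x + snd (ln e)"
        using cross[OF c(1)] by blast
      obtain y where y: "d' \<in> D" "e' \<in> D" "over_edge y d'" "over_edge y e'"
          "fst (ln d) * y + snd (ln d) = fst (ln e) * y + snd (ln e)"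
        using cross[OF c(2)] eq by metis
      have "x = y" using line_eqI[OF x(6) y(5)] x(5) by blast
      then show "u = v"
        using same_edge[OF x(1) y(1) eq(1) x(3)] same_edge[OF x(2) y(2) eq(2) x(4)] y(3,4) by simp
    qed
    show "(\<lambda>(d, e). (ln d, ln e)) ` crossings \<subseteq> L \<times> L"
    proof (rule image_subsetI)
      fix u assume u: "u \<in> crossings"
      obtain d e where [simp]: "u = (d, e)"
        by (metis surj_pair)
      have "d \<in> D" "e \<in> D"
        using u by (simp_all add: crossings_def)
      then show "(\<lambda>(d, e). (ln d, ln e)) u \<in> L \<times> L"
        using D_D(4)[of d] D_D(4)[of e] by (simp add: link_def)
    qed
  qed (use L in simp)
  then have "real (card crossings) \<le> real (card L * card L)"
    by (simp only: card_cartesian_product of_nat_le_iff)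
  then have crossings: "real (card crossings) \<le> (real (card L))\<^sup>2"
    by (simp add: power2_eq_square)
  \<comment> \<open>A shared end would be a second common point of the two lines, since the crossing
    lies strictly inside both edges.\<close>
  have four: "card {fst d, snd d, fst e, snd e} = 4" if c: "(d, e) \<in> crossings" for d e
  proof -
    obtain x where x: "d \<in> D" "e \<in> D" "over_edge x d" "over_edge x e" "ln d \<noteq> ln e"
        "fst (ln d) * x + snd (ln d) = fst (ln e) * x + snd (ln e)"
      using cross[OF c] by blast
    have "r \<noteq> s" if "r \<in> {fst d, snd d}" "s \<in> {fst e, snd e}" for r s
    proof
      assume "r = s"
      then have "on_line (ln d) r" "on_line (ln e) r" "fst r \<noteq> x"
        using that D_D(4)[OF x(1)] D_D(4)[OF x(2)] x(3,4) by (auto simp: link_def over_edge_def)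
      then show False
        using line_eqI[OF x(6), of "fst r"] x(5) by (simp add: on_line_def)
    qed
    then have "fst d \<noteq> fst e" "fst d \<noteq> snd e" "snd d \<noteq> fst e" "snd d \<noteq> snd e"
      by blast+
    moreover have "fst d \<noteq> snd d" "fst e \<noteq> snd e"
      using D_D(3)[OF x(1)] D_D(3)[OF x(2)] by auto
    ultimately show ?thesis by simp
  qed
  let ?I = "{(l, p). l \<in> L \<and> p \<in> P \<and> on_line l p}"
  \<comment> \<open>Incidences with no later point number at most one per line. Any other is charged
    to the edge from \<open>p\<close> to the next point, and this edge determines the line.\<close>
  define R where "R l p = {r \<in> P. on_line l r \<and> fst p < fst r}" for l p :: "real \<times> real"
  let ?last = "{(l, p) \<in> ?I. R l p = {}}"
  let ?rest = "{(l, p) \<in> ?I. R l p \<noteq> {}}"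
  have "card ?last \<le> card L"
  proof (rule card_inj_on_le[of fst])
    show "inj_on fst ?last"
    proof (rule inj_onI)
      fix u v assume uv: "u \<in> ?last" "v \<in> ?last" "fst u = fst v"
      obtain l p q where [simp]: "u = (l, p)" "v = (l, q)"
        using uv(3) by (metis prod.collapse)
      have "p \<in> P" "q \<in> P" "on_line l p" "on_line l q" "q \<notin> R l p" "p \<notin> R l q"
        using uv(1,2) by simp_all
      then have "\<not> fst p < fst q" "\<not> fst q < fst p"
        by (simp_all add: R_def)
      then have "fst p = fst q"
        by linarith
      with \<open>p \<in> P\<close> \<open>q \<in> P\<close> have "p = q"
        by (rule P_eqI)
      then show "u = v"
        by simp
    qed
    show "fst ` ?last \<subseteq> L"
      by (rule image_subsetI) (simp only: mem_Collect_eq split_beta fst_conv snd_conv)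
  qed (rule L)
  moreover have "card ?rest \<le> card D"
  proof (rule card_inj_on_le[of "\<lambda>(l, p). (p, arg_min_on fst (R l p))"])
    have next_pt: "arg_min_on fst (R l p) \<in> R l p" "r \<in> R l p \<Longrightarrow> fst (arg_min_on fst (R l p)) \<le> fst r"
      if "(l, p) \<in> ?rest" for l p r
    proof -
      have fin: "finite (R l p)" "R l p \<noteq> {}"
      proof -
        show "finite (R l p)"
          using P(1) by (simp add: R_def)
        show "R l p \<noteq> {}"
          using that by simp
      qed
      show "arg_min_on fst (R l p) \<in> R l p"
        by (rule arg_min_if_finite(1)[OF fin])
      show "fst (arg_min_on fst (R l p)) \<le> fst r" if "r \<in> R l p"
        by (rule arg_min_least[OF fin that])
    qed
    show "inj_on (\<lambda>(l, p). (p, arg_min_on fst (R l p))) ?rest"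
    proof (rule inj_onI)
      fix u v
      assume uv: "u \<in> ?rest" "v \<in> ?rest"
        and eq: "(\<lambda>(l, p). (p, arg_min_on fst (R l p))) u = (\<lambda>(l, p). (p, arg_min_on fst (R l p))) v"
      obtain l p l' p' where lp: "u = (l, p)" "v = (l', p')"
        by (metis surj_pair)
      define q where "q = arg_min_on fst (R l p)"
      have p': "p' = p" and q': "arg_min_on fst (R l' p') = q"
        using eq[unfolded lp split_conv prod.inject] unfolding q_def
        by (rule conjunct1[THEN sym], rule conjunct2[THEN sym])
      have rest: "(l, p) \<in> ?rest" "(l', p') \<in> ?rest"
        using uv unfolding lp .
      have q: "q \<in> R l p" "q \<in> R l' p"
        using next_pt(1)[OF rest(1)] next_pt(1)[OF rest(2)] unfolding q' unfolding p' q_def .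
      have "on_line l p" "on_line l' p"
        using rest unfolding p' by simp_all
      moreover have "on_line l q" "on_line l' q" "fst p \<noteq> fst q"
        using q unfolding R_def by simp_all
      ultimately have "l = l'"
        using line_eqI[of l "fst p" l' "fst q"] unfolding on_line_def by metis
      then show "u = v"
        unfolding lp p' by simp
    qed
    show "(\<lambda>(l, p). (p, arg_min_on fst (R l p))) ` ?rest \<subseteq> D"
    proof (rule image_subsetI)
      fix u assume u: "u \<in> ?rest"
      obtain l p where lp: "u = (l, p)"
        by (metis surj_pair)
      have rest: "(l, p) \<in> ?rest"
        using u unfolding lp .
      then have p: "l \<in> L" "p \<in> P" "on_line l p"
        by simp_all
      define q where "q = arg_min_on fst (R l p)"
      have q: "q \<in> P" "on_line l q" "fst p < fst q"
        using next_pt(1)[OF rest] unfolding R_def q_def by simp_all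
      have "\<not> over_edge (fst r) (p, q)" if "r \<in> P" "on_line l r" for r
      proof
        assume over: "over_edge (fst r) (p, q)"
        then have "r \<in> R l p"
          using that by (simp add: R_def over_edge_def)
        then show False
          using next_pt(2)[OF rest] over by (fastforce simp: over_edge_def q_def)
      qed
      then have "link l (p, q)"
        using p q by (simp add: link_def)
      then have "\<exists>l. link l (p, q)"
        by blast
      then have "(p, q) \<in> D"
        using p q by (simp add: D_def del: split_paired_Ex)
      then show "(\<lambda>(l, p). (p, arg_min_on fst (R l p))) u \<in> D"
        by (simp add: lp q_def)
    qed
  qed (rule finite_edges)
  moreover have "card ?I \<le> card ?last + card ?rest"
  proof -
    have "?I = ?last \<union> ?rest"
    proof (intro equalityI subsetI)
      fix u assume u: "u \<in> ?I"
      obtain l p where lp: "u = (l, p)"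
        by (metis surj_pair)
      show "u \<in> ?last \<union> ?rest"
        using u unfolding lp by (cases "R l p = {}") simp_all
    next
      fix u assume u: "u \<in> ?last \<union> ?rest"
      obtain l p where lp: "u = (l, p)"
        by (metis surj_pair)
      show "u \<in> ?I"
        using u unfolding lp by (cases "R l p = {}") simp_all
    qed
    then show ?thesis
      using card_Un_le[of ?last ?rest] by (simp only:)
  qed
  ultimately have "real (card ?I) \<le> real (card L) + real (card D)"
    by linarith
  also have "real (card D) \<le> 3 * real (card P) * real m + (real (card L))\<^sup>2 / (real m)\<^sup>2"
    using crossing_lemma[OF \<open>0 < m\<close> four] divide_right_mono[OF crossings, of "(real m)\<^sup>2"] by simp
  finally show ?thesis by simp
qed

section \<open>Dot products as incidences, and dot product triangles\<close>

lemma inner_real_2: "x \<bullet> y = x $ 1 * y $ 1 + x $ 2 * y $ 2" for x y :: "real ^ 2"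
  by (simp add: inner_vec_def sum_2)

lemma real_2_eq_iff: "x = y \<longleftrightarrow> x $ 1 = y $ 1 \<and> x $ 2 = y $ 2" for x y :: "real ^ 2"
  by (simp add: vec_eq_iff forall_2)

text \<open>\<open>szemeredi_trotter\<close> wants points with distinct abscissae and lines that
  have a slope. After the shear to \<open>(y $ 1 + t * y $ 2, y $ 2)\<close>, the line of a nonzero
  \<open>x\<close> is vertical just when \<open>x $ 2 = t * x $ 1\<close>, so both demands exclude
  only finitely many \<open>t\<close>.\<close>

lemma generic_shear:
  fixes E :: "(real ^ 2) set"
  assumes "finite E"
  obtains t :: real where "inj_on (\<lambda>p. p $ 1 + t * p $ 2) E"
    and "\<And>x. x \<in> E \<Longrightarrow> x \<noteq> 0 \<Longrightarrow> x $ 2 \<noteq> t * x $ 1"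
proof -
  \<comment> \<open>Quotients with denominator 0 only add the value 0 to the excluded ones.\<close>
  let ?B = "(\<lambda>(p, q). (q $ 1 - p $ 1) / (p $ 2 - q $ 2)) ` (E \<times> E) \<union> (\<lambda>x. x $ 2 / x $ 1) ` E"
  have "finite ?B"
    using assms by simp
  then obtain t where t: "t \<notin> ?B"
    using ex_new_if_finite[OF infinite_UNIV_char_0] by blast
  show thesis
  proof (rule that)
    show "inj_on (\<lambda>p. p $ 1 + t * p $ 2) E"
    proof (rule inj_onI)
      fix p q assume pq: "p \<in> E" "q \<in> E" "p $ 1 + t * p $ 2 = q $ 1 + t * q $ 2"
      then have eq: "t * (p $ 2 - q $ 2) = q $ 1 - p $ 1"
        by (simp add: algebra_simps)
      have "p $ 2 = q $ 2"
      proof (rule ccontr)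
        assume "p $ 2 \<noteq> q $ 2"
        then have "t = (q $ 1 - p $ 1) / (p $ 2 - q $ 2)"
          using eq by (simp add: eq_divide_eq)
        then have "t \<in> (\<lambda>(p, q). (q $ 1 - p $ 1) / (p $ 2 - q $ 2)) ` (E \<times> E)"
          using pq(1,2) by (intro image_eqI[of _ _ "(p, q)"]) auto
        then show False using t by blast
      qed
      then show "p = q"
        using eq by (simp add: real_2_eq_iff)
    qed
    show "x $ 2 \<noteq> t * x $ 1" if "x \<in> E" "x \<noteq> 0" for x
    proof
      assume eq: "x $ 2 = t * x $ 1"
      then have "x $ 1 \<noteq> 0"
        using that(2) by (auto simp: real_2_eq_iff)
      then have "t = x $ 2 / x $ 1"
        using eq by simp
      then show False using t that(1) by blast
    qed
  qed
qed

theorem dot_product_incidences: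
  fixes E :: "(real ^ 2) set"
  assumes E: "finite E" and a: "a \<noteq> 0" and m: "0 < m"
  shows "real (card {(x, y). x \<in> E \<and> y \<in> E \<and> x \<bullet> y = a}) \<le>
    real (card E) + 3 * real (card E) * real m + (real (card E))\<^sup>2 / (real m)\<^sup>2"
proof -
  obtain t where inj: "inj_on (\<lambda>p. p $ 1 + t * p $ 2) E"
    and nonvertical: "\<And>x. x \<in> E \<Longrightarrow> x \<noteq> 0 \<Longrightarrow> x $ 2 \<noteq> t * x $ 1"
    using generic_shear[OF E] by blast
  define pt where "pt y = (y $ 1 + t * y $ 2, y $ 2)" for y :: "real ^ 2"
  \<comment> \<open>In sheared coordinates \<open>x \<bullet> y = a\<close> reads \<open>x $ 1 * (y
    $ 1 + t * y $ 2) + (x $ 2 - t * x $ 1) * y $ 2 = a\<close>, solved here for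
    \<open>y $ 2\<close>.\<close>
  define line where "line x = (- (x $ 1) / (x $ 2 - t * x $ 1), a / (x $ 2 - t * x $ 1))" for x :: "real ^ 2"
  let ?J = "{(x, y). x \<in> E \<and> y \<in> E \<and> x \<bullet> y = a}"
  \<comment> \<open>The origin gives no line and, as \<open>a\<close> is nonzero, occurs in no
    pair.\<close>
  let ?L = "line ` (E - {0})" and ?P = "pt ` E"
  let ?I = "{(l, p). l \<in> ?L \<and> p \<in> ?P \<and> on_line l p}"
  have inj_pt: "inj_on pt E"
    using inj by (auto simp: inj_on_def pt_def)
  \<comment> \<open>As \<open>a\<close> is nonzero, the intercept determines the common denominator,
    and the slope then determines \<open>x $ 1\<close>.\<close>
  have inj_line: "inj_on line (E - {0})"
  proof (rule inj_onI)
    fix x y assume xy: "x \<in> E - {0}" "y \<in> E - {0}" "line x = line y"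
    then have nz: "x $ 2 - t * x $ 1 \<noteq> 0" "y $ 2 - t * y $ 1 \<noteq> 0"
      using nonvertical by auto
    have "a / (x $ 2 - t * x $ 1) = a / (y $ 2 - t * y $ 1)"
      using xy(3) by (simp add: line_def)
    then have "x $ 2 - t * x $ 1 = y $ 2 - t * y $ 1"
      using a nz by (simp add: frac_eq_eq)
    moreover from this have "x $ 1 = y $ 1"
      using xy(3) nz by (simp add: line_def)
    ultimately show "x = y"
      by (simp add: real_2_eq_iff)
  qed
  have incident: "x \<in> E - {0}" "on_line (line x) (pt y)" if "x \<in> E" "x \<bullet> y = a" for x y
  proof -
    show x: "x \<in> E - {0}"
      using that a by auto
    then have nz: "x $ 2 - t * x $ 1 \<noteq> 0"
      using nonvertical by auto
    have "y $ 2 * (x $ 2 - t * x $ 1) = - (x $ 1) * (y $ 1 + t * y $ 2) + a"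
      using that(2) unfolding inner_real_2 by (simp add: algebra_simps)
    then have "y $ 2 = (- (x $ 1) * (y $ 1 + t * y $ 2) + a) / (x $ 2 - t * x $ 1)"
      using nz by (simp add: eq_divide_eq)
    then show "on_line (line x) (pt y)"
      unfolding on_line_def line_def pt_def fst_conv snd_conv add_divide_distrib by simp
  qed
  have fin: "finite ?L" "finite ?P"
    using E by auto
  have "card ?J \<le> card ?I"
  proof (rule card_inj_on_le[of "map_prod line pt"])
    have "?J \<subseteq> (E - {0}) \<times> E"
      using incident(1) by blast
    then show "inj_on (map_prod line pt) ?J"
      using map_prod_inj_on[OF inj_line inj_pt] inj_on_subset by blast
    show "map_prod line pt ` ?J \<subseteq> ?I"
      using incident by auto
    show "finite ?I"
      by (rule finite_subset[of _ "?L \<times> ?P"]) (use fin in auto)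
  qed
  also have "real (card ?I) \<le> real (card ?L) + 3 * real (card ?P) * real m + (real (card ?L))\<^sup>2 / (real m)\<^sup>2"
  proof (rule szemeredi_trotter[OF fin(2) _ fin(1) m])
    show "inj_on fst ?P"
      using inj by (auto simp: inj_on_def pt_def)
  qed
  also have "\<dots> \<le> real (card E) + 3 * real (card E) * real m + (real (card E))\<^sup>2 / (real m)\<^sup>2"
  proof -
    have "card ?L \<le> card E" "card ?P \<le> card E"
      using E card_image_le[of "E - {0}" line] card_image_le[of E pt] card_mono[of E "E - {0}"] by auto
    then show ?thesis
      by (intro add_mono mult_mono divide_right_mono power_mono) auto
  qed
  finally show ?thesis by simp
qed

corollary dot_product_incidences_powr:
  fixes E :: "(real ^ 2) set"
  assumes E: "finite E" and a: "a \<noteq> 0"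
  shows "real (card {(x, y). x \<in> E \<and> y \<in> E \<and> x \<bullet> y = a}) \<le> 8 * real (card E) powr (4 / 3)"
proof (cases "E = {}")
  case False
  define n where "n = real (card E)"
  have n: "1 \<le> n"
    using False E card_gt_0_iff[of E] by (simp add: n_def Suc_le_eq)
  \<comment> \<open>With \<open>m\<close> of order \<open>n powr (1 / 3)\<close>, both
    \<open>n * m\<close> and \<open>n\<^sup>2 / m\<^sup>2\<close> are of order
    \<open>n powr (4 / 3)\<close>.\<close>
  define r where "r = n powr (1 / 3)"
  have r: "1 \<le> r"
    using n by (simp add: r_def ge_one_powr_ge_zero)
  define m where "m = nat \<lceil>r\<rceil>"
  have m: "r \<le> real m" "real m \<le> 2 * r" "0 < m"
    using r unfolding m_def by linarith+
  have n4: "n powr (4 / 3) = n * r"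
    using n by (simp add: r_def powr_mult_base)
  have n3: "n = r ^ 3"
    using n by (simp add: r_def powr_realpow [symmetric] powr_powr)
  have "n\<^sup>2 / (real m)\<^sup>2 \<le> n\<^sup>2 / r\<^sup>2"
    using m r by (intro divide_left_mono power_mono) auto
  also have "n\<^sup>2 / r\<^sup>2 = n * r"
    using r n3 by (simp add: field_simps power2_eq_square power3_eq_cube)
  \<comment> \<open>The three terms contribute 1, 6 and 1 to the constant 8.\<close>
  finally have "n + 3 * n * real m + n\<^sup>2 / (real m)\<^sup>2 \<le> n * r + 3 * n * (2 * r) + n * r"
    using n r m by (intro add_mono mult_left_mono) auto
  then show ?thesis
    using dot_product_incidences[OF E a m(3)] n4 unfolding n_def by (simp add: mult.commute)
qed simp

text \<open>Two linearly independent vertices of a triangle determine the third. If the first two are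
  dependent, then \<open>y = (b/c) x\<close>, so that \<open>(x, z)\<close> determines the triangle.\<close>

lemma card_dot_triangles_le:
  fixes E :: "(real ^ 2) set"
  assumes E: "finite E" and nz: "a \<noteq> 0" "c \<noteq> 0"
  shows "card {(x, y, z). x \<in> E \<and> y \<in> E \<and> z \<in> E \<and> x \<bullet> y = a \<and> y \<bullet> z = b \<and> z \<bullet> x = c} \<le>
    card {(x, y). x \<in> E \<and> y \<in> E \<and> x \<bullet> y = a} + card {(x, y). x \<in> E \<and> y \<in> E \<and> x \<bullet> y = c}"
    (is "card ?T \<le> card ?A + card ?C")
proof -
  define det where "det x y = x $ 1 * y $ 2 - x $ 2 * y $ 1" for x y :: "real ^ 2"
  have fin: "finite ?A" "finite ?C"
    using E by (auto intro: finite_subset[of _ "E \<times> E"])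
  have "finite ?T"
    by (rule finite_subset[of _ "E \<times> E \<times> E"]) (use E in auto)
  have third: "z = z'" if "det x y \<noteq> 0" "y \<bullet> z = y \<bullet> z'" "z \<bullet> x = z' \<bullet> x" for x y z z' :: "real ^ 2"
  proof -
    have "det x y * (z $ 2 - z' $ 2) = 0" "det x y * (z $ 1 - z' $ 1) = 0"
      using that(2,3) unfolding det_def inner_real_2 by algebra+
    then show ?thesis
      using that(1) by (simp add: real_2_eq_iff)
  qed
  \<comment> \<open>For parallel \<open>x\<close> and \<open>y\<close>,
    \<open>(z \<bullet> x) *\<^sub>R y = (y \<bullet> z) *\<^sub>R x\<close>.\<close>
  have second: "y = (b / c) *\<^sub>R x" if "det x y = 0" "y \<bullet> z = b" "z \<bullet> x = c" for x y z :: "real ^ 2"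
  proof -
    have "c * y $ 1 = b * x $ 1" "c * y $ 2 = b * x $ 2"
      using that unfolding det_def inner_real_2 by algebra+
    then show ?thesis
      using nz(2) by (simp add: real_2_eq_iff field_simps)
  qed
  let ?T1 = "{(x, y, z) \<in> ?T. det x y \<noteq> 0}" and ?T2 = "{(x, y, z) \<in> ?T. det x y = 0}"
  have "card ?T1 \<le> card ?A"
  proof (rule card_inj_on_le[of "\<lambda>(x, y, z). (x, y)"])
    show "inj_on (\<lambda>(x, y, z). (x, y)) ?T1"
      using third by (auto simp: inj_on_def)
  qed (use fin in auto)
  moreover have "card ?T2 \<le> card ?C"
  proof (rule card_inj_on_le[of "\<lambda>(x, y, z). (x, z)"])
    show "inj_on (\<lambda>(x, y, z). (x, z)) ?T2"
    proof (rule inj_onI)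
      fix u v assume uv: "u \<in> ?T2" "v \<in> ?T2" "(\<lambda>(x, y, z). (x, z)) u = (\<lambda>(x, y, z). (x, z)) v"
      obtain x y z y' where u: "u = (x, y, z)" "v = (x, y', z)"
        using uv(3) by (cases u, cases v) auto
      have "y = (b / c) *\<^sub>R x" "y' = (b / c) *\<^sub>R x"
        using uv(1,2) unfolding u by (intro second[of x _ z]; simp)+
      then show "u = v"
        by (simp add: u)
    qed
  qed (use fin in \<open>auto simp: inner_commute\<close>)
  moreover have "card ?T \<le> card ?T1 + card ?T2"
  proof -
    have "?T \<subseteq> ?T1 \<union> ?T2" by auto
    moreover have "finite (?T1 \<union> ?T2)"
      by (rule finite_subset[OF _ \<open>finite ?T\<close>]) auto
    ultimately have "card ?T \<le> card (?T1 \<union> ?T2)"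
      by (intro card_mono)
    also have "\<dots> \<le> card ?T1 + card ?T2"
      by (rule card_Un_le)
    finally show ?thesis .
  qed
  ultimately show ?thesis by linarith
qed

section \<open>Triangle configurations and the two bounds on their maximum\<close>

lemma triangle_config_iff:
  "dot_product_config triangle_graph w X \<longleftrightarrow>
    (\<exists>x y z. length X = 3 \<and> set X = {x, y, z} \<and> distinct [x, y, z] \<and>
      x \<bullet> y = w {0, 1} \<and> y \<bullet> z = w {1, 2} \<and> z \<bullet> x = w {2, 0})" (is "_ \<longleftrightarrow> ?R")
proof
  assume "dot_product_config triangle_graph w X"
  then obtain \<phi> where len: "length X = card (verts triangle_graph)"
    and bij: "bij_betw \<phi> (verts triangle_graph) (set X)"
    and dot: "\<And>u v. {u, v} \<in> edges triangle_graph \<Longrightarrow> \<phi> u \<bullet> \<phi> v = w {u, v}"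
    unfolding dot_product_config_def by blast
  have len: "length X = 3" and bij: "bij_betw \<phi> {0, 1, 2} (set X)"
    using len bij by (simp_all add: triangle_graph_def)
  have "set X = {\<phi> 0, \<phi> 1, \<phi> 2}"
    using bij by (auto simp: bij_betw_def)
  moreover have "distinct [\<phi> 0, \<phi> 1, \<phi> 2]"
    using bij by (auto simp: bij_betw_def inj_on_def)
  moreover have "\<phi> 0 \<bullet> \<phi> 1 = w {0, 1}" "\<phi> 1 \<bullet> \<phi> 2 = w {1, 2}" "\<phi> 2 \<bullet> \<phi> 0 = w {2, 0}"
    by (rule dot, simp add: triangle_graph_def)+
  ultimately show ?R
    using len by blast
next
  assume ?R
  then obtain x y z where X: "length X = 3" "set X = {x, y, z}" "distinct [x, y, z]"
    and dot: "x \<bullet> y = w {0, 1}" "y \<bullet> z = w {1, 2}" "z \<bullet> x = w {2, 0}"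
    by blast
  let ?\<phi> = "\<lambda>v::nat. if v = 0 then x else if v = 1 then y else z"
  have "bij_betw ?\<phi> {0, 1, 2} (set X)"
    using X(2,3) by (auto simp: bij_betw_def inj_on_def)
  moreover have "?\<phi> u \<bullet> ?\<phi> v = w {u, v}" if "{u, v} \<in> {{0, 1}, {1, 2}, {2, 0}}" for u v
    using that dot by (auto simp: doubleton_eq_iff inner_commute insert_commute)
  ultimately show "dot_product_config triangle_graph w X"
    using X(1) unfolding dot_product_config_def triangle_graph_def fst_conv snd_conv
    by (intro conjI exI[of _ ?\<phi>]) auto
qed

text \<open>The bijection of a configuration ignores the order of the list, so one labelled triangle
  accounts for several lists, at most \<open>3 ^ 3 = 27\<close>. Two incidence bounds with constant
  8 then give \<open>27 * 16 = 432\<close>.\<close>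

lemma card_triangle_configs_le:
  fixes E :: "(real ^ 2) set"
  assumes E: "finite E" and w: "nonzero_weights triangle_graph w"
  shows "real (card {X. dot_product_config triangle_graph w X \<and> set X \<subseteq> E}) \<le> 432 * real (card E) powr (4 / 3)"
proof -
  let ?T = "{(x, y, z). x \<in> E \<and> y \<in> E \<and> z \<in> E \<and> x \<bullet> y = w {0, 1} \<and> y \<bullet> z = w {1, 2} \<and> z \<bullet> x = w {2, 0}}"
  let ?N = "\<lambda>(x, y, z). {X. set X \<subseteq> {x, y, z} \<and> length X = 3}"
  have nz: "w {0, 1} \<noteq> 0" "w {2, 0} \<noteq> 0"
    using w by (auto simp: nonzero_weights_def triangle_graph_def)
  have fin: "finite ?T"
    by (rule finite_subset[of _ "E \<times> E \<times> E"]) (use E in auto)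
  have N: "finite (?N t) \<and> card (?N t) \<le> 27" for t :: "(real ^ 2) \<times> (real ^ 2) \<times> (real ^ 2)"
  proof (cases t)
    case (fields x y z)
    have "card {x, y, z} ^ 3 \<le> 3 ^ 3"
      by (intro power_mono) (auto simp: card_insert_if)
    then show ?thesis
      by (simp add: fields card_lists_length_eq finite_lists_length_eq)
  qed
  have "{X. dot_product_config triangle_graph w X \<and> set X \<subseteq> E} \<subseteq> (\<Union>t\<in>?T. ?N t)"
  proof
    fix X assume "X \<in> {X. dot_product_config triangle_graph w X \<and> set X \<subseteq> E}"
    then obtain x y z where "length X = 3" "set X = {x, y, z}" "set X \<subseteq> E"
        "x \<bullet> y = w {0, 1}" "y \<bullet> z = w {1, 2}" "z \<bullet> x = w {2, 0}"
      by (auto simp: triangle_config_iff)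
    then show "X \<in> (\<Union>t\<in>?T. ?N t)"
      by (intro UN_I[of "(x, y, z)"]) auto
  qed
  then have "card {X. dot_product_config triangle_graph w X \<and> set X \<subseteq> E} \<le> card (\<Union>t\<in>?T. ?N t)"
    using fin N by (intro card_mono finite_UN_I) auto
  also have "\<dots> \<le> (\<Sum>t\<in>?T. card (?N t))"
    by (rule card_UN_le[OF fin])
  also have "\<dots> \<le> 27 * card ?T"
    using sum_bounded_above[of ?T "\<lambda>t. card (?N t)" 27] N by (simp add: mult.commute)
  finally have "real (card {X. dot_product_config triangle_graph w X \<and> set X \<subseteq> E}) \<le> 27 * real (card ?T)"
    by linarith
  also have "real (card ?T) \<le> 16 * real (card E) powr (4 / 3)"
    using card_dot_triangles_le[OF E nz, of "w {1, 2}"]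
      dot_product_incidences_powr[OF E nz(1)] dot_product_incidences_powr[OF E nz(2)] by linarith
  finally show ?thesis by simp
qed

text \<open>A configuration is a list of fixed length over an \<open>n\<close>-point set, which
  bounds all these cardinalities at once and makes \<open>Max\<close> meaningful.\<close>

lemma finite_config_cards:
  "finite {card {X. dot_product_config G w X \<and> set X \<subseteq> E} | E. finite E \<and> card E = n}" (is "finite ?S")
proof (rule finite_subset)
  show "?S \<subseteq> {..n ^ card (verts G)}"
  proof
    fix k assume "k \<in> ?S"
    then obtain E where E: "finite E" "card E = n"
      and k: "k = card {X. dot_product_config G w X \<and> set X \<subseteq> E}"
      by blast
    have "card {X. dot_product_config G w X \<and> set X \<subseteq> E} \<le> card {X. set X \<subseteq> E \<and> length X = card (verts G)}"
      using E(1) by (intro card_mono finite_lists_length_eq) (auto simp: dot_product_config_def)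
    then show "k \<in> {..n ^ card (verts G)}"
      using E k by (simp add: card_lists_length_eq)
  qed
qed simp

lemma max_configs_ge:
  assumes "finite E"
  shows "card {X. dot_product_config G w X \<and> set X \<subseteq> E} \<le> max_configs G w (card E)"
  unfolding max_configs_def using assms by (intro Max_ge finite_config_cards) auto

lemma max_configs_attained:
  obtains E where "finite E" "card E = n"
    "max_configs G w n = card {X. dot_product_config G w X \<and> set X \<subseteq> E}"
proof -
  \<comment> \<open>The plane is infinite, so the maximum is over a nonempty collection.\<close>
  obtain E0 :: "(real ^ 2) set" where "finite E0" "card E0 = n"
    using infinite_arbitrarily_large[of "UNIV :: (real ^ 2) set" n] infinite_UNIV_char_0
    by blast
  then have "max_configs G w n \<in> {card {X. dot_product_config G w X \<and> set X \<subseteq> E} | E. finite E \<and> card E = n}"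
    unfolding max_configs_def by (intro Max_in finite_config_cards) auto
  then show thesis
    using that by blast
qed

lemma max_triangle_configs_le:
  assumes "nonzero_weights triangle_graph w"
  shows "real (max_configs triangle_graph w n) \<le> 432 * real n powr (4 / 3)"
proof -
  obtain E where E: "finite E" "card E = n"
    and max: "max_configs triangle_graph w n = card {X. dot_product_config triangle_graph w X \<and> set X \<subseteq> E}"
    by (rule max_configs_attained)
  show ?thesis
    unfolding max using card_triangle_configs_le[OF E(1) assms] unfolding E(2) .
qed

text \<open>The points \<open>(1, 0)\<close>, \<open>(2, 0)\<close> and \<open>(1, s)\<close> have the same dot products for every \<open>s\<close>.\<close>

lemma max_triangle_configs_ge:
  defines "w \<equiv> \<lambda>e :: nat set. if e = {2, 0} then 1 else 2 :: real"
  shows "n \<le> max_configs triangle_graph w (n + 2)"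
proof -
  define x y :: "real ^ 2" where "x = vector [1, 0]" and "y = vector [2, 0]"
  \<comment> \<open>The second coordinate starts at 1, because the value 0 would give
    \<open>x\<close>.\<close>
  define z :: "nat \<Rightarrow> real ^ 2" where "z i = vector [1, real (Suc i)]" for i
  define E where "E = insert x (insert y (z ` {..<n}))"
  have inj: "inj z"
    by (auto simp: inj_on_def z_def real_2_eq_iff)
  have distinct: "x \<noteq> y" "x \<noteq> z i" "y \<noteq> z i" for i
    by (auto simp: x_def y_def z_def real_2_eq_iff)
  have E: "finite E" "card E = n + 2"
    using distinct card_image[OF inj_on_subset[OF inj subset_UNIV], of "{..<n}"]
    by (auto simp: E_def card_insert_if)
  have "dot_product_config triangle_graph w [x, y, z i]" for i
    unfolding triangle_config_iff using distinct
    by (intro exI[of _ x] exI[of _ y] exI[of _ "z i"])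
      (auto simp: w_def x_def y_def z_def inner_real_2 doubleton_eq_iff)
  then have "(\<lambda>i. [x, y, z i]) ` {..<n} \<subseteq> {X. dot_product_config triangle_graph w X \<and> set X \<subseteq> E}"
    by (auto simp: E_def)
  moreover have "finite {X. dot_product_config triangle_graph w X \<and> set X \<subseteq> E}"
    by (rule finite_subset[OF _ finite_lists_length_eq[OF E(1), of 3]])
      (auto simp: triangle_config_iff)
  ultimately have "card ((\<lambda>i. [x, y, z i]) ` {..<n}) \<le> card {X. dot_product_config triangle_graph w X \<and> set X \<subseteq> E}"
    by (intro card_mono)
  also have "card ((\<lambda>i. [x, y, z i]) ` {..<n}) = n"
    using inj by (subst card_image) (auto simp: inj_on_def)
  finally show ?thesis
    using max_configs_ge[OF E(1), of triangle_graph w] E(2) by simp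
qed

theorem mainTheorem1:
  "(\<exists>w. nonzero_weights triangle_graph w \<and>
        (\<lambda>n. real (max_configs triangle_graph w n)) \<greatersim> (\<lambda>n. real n)) \<and>
   (\<forall>w. nonzero_weights triangle_graph w \<longrightarrow>
        (\<lambda>n. real (max_configs triangle_graph w n)) \<lesssim> (\<lambda>n. real n powr (4 / 3)))"
proof
  define w :: "nat set \<Rightarrow> real" where "w = (\<lambda>e. if e = {2, 0} then 1 else 2)"
  have "nonzero_weights triangle_graph w"
    by (simp add: nonzero_weights_def w_def)
  \<comment> \<open>There are at least \<open>n - 2\<close> configurations, and
    \<open>n \<le> 3 * (n - 2)\<close> from \<open>n = 3\<close> on.\<close>
  moreover have "real n \<le> 3 * real (max_configs triangle_graph w n)" if "2 < n" for n
  proof -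
    have "n - 2 \<le> max_configs triangle_graph w (n - 2 + 2)"
      unfolding w_def by (rule max_triangle_configs_ge)
    moreover have "n - 2 + 2 = n"
      using that by linarith
    ultimately have "n - 2 \<le> max_configs triangle_graph w n"
      by metis
    then show ?thesis
      using that by linarith
  qed
  ultimately show "\<exists>w. nonzero_weights triangle_graph w \<and>
      (\<lambda>n. real (max_configs triangle_graph w n)) \<greatersim> (\<lambda>n. real n)"
    unfolding lesssim_def by blast
  show "\<forall>w. nonzero_weights triangle_graph w \<longrightarrow>
      (\<lambda>n. real (max_configs triangle_graph w n)) \<lesssim> (\<lambda>n. real n powr (4 / 3))"
    unfolding lesssim_def using max_triangle_configs_le by blast
qed

end
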